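(* Let $C$ be the Cesàro operator on $L^2(0,1)$, $(Cf)(x)=\frac1x\int_0^x\frac{f(t)}{1-t}\,dt$ for $0<x<1$. Then $\sigma_p(C)=\sigma_p(C^* )=\varnothing$; that is, neither $C$ nor its adjoint $C^*$ has any eigenvalues.
   Context: $L^2(0,1)$ is the Hilbert space of complex-valued square-integrable functions on $(0,1)$ with respect to Lebesgue measure; $C$ is a bounded linear operator on it. $\sigma_p(T)$ denotes the point spectrum (set of complex eigenvalues) of a bounded operator $T$. *)

theory Defs
  imports "HOL-Analysis.Analysis"
begin

section \<open>The complex Hilbert space $L^2(0,1)$\<close>

abbreviation unit_measure :: "real measure" where
  "unit_measure \<equiv> lebesgue_on {0<..<1}"

definition square_integrable :: "(real \<Rightarrow> complex) \<Rightarrow> bool" where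
  "square_integrable f \<longleftrightarrow>
     f \<in> borel_measurable unit_measure \<and> integrable unit_measure (\<lambda>x. (norm (f x))\<^sup>2)"

definition l2_eq :: "(real \<Rightarrow> complex) \<Rightarrow> (real \<Rightarrow> complex) \<Rightarrow> bool" where
  "l2_eq f g \<longleftrightarrow>
     square_integrable f \<and> square_integrable g \<and> (AE x in unit_measure. f x = g x)"

lemma square_integrable_zero: "square_integrable (\<lambda>x. 0)"
  by (simp add: square_integrable_def)

lemma square_integrable_scale:
  assumes "square_integrable f"
  shows "square_integrable (\<lambda>x. c * f x)"
  using assms by (auto simp: square_integrable_def norm_mult power_mult_distrib)

lemma square_integrable_add:
  assumes "square_integrable f" "square_integrable g"
  shows "square_integrable (\<lambda>x. f x + g x)"
proof -
  have [measurable]: "f \<in> borel_measurable unit_measure" "g \<in> borel_measurable unit_measure"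
    using assms by (auto simp: square_integrable_def)
  have "integrable unit_measure (\<lambda>x. 2 * (norm (f x))\<^sup>2 + 2 * (norm (g x))\<^sup>2)"
    using assms by (auto simp: square_integrable_def)
  then have "integrable unit_measure (\<lambda>x. (norm (f x + g x))\<^sup>2)"
  proof (rule Bochner_Integration.integrable_bound)
    have "(norm (f x + g x))\<^sup>2 \<le> 2 * (norm (f x))\<^sup>2 + 2 * (norm (g x))\<^sup>2" for x
    proof -
      have "(norm (f x + g x))\<^sup>2 \<le> (norm (f x) + norm (g x))\<^sup>2"
        by (intro power_mono norm_triangle_ineq) auto
      also have "\<dots> \<le> 2 * (norm (f x))\<^sup>2 + 2 * (norm (g x))\<^sup>2"
        using sum_squares_bound[of "norm (f x)" "norm (g x)"] by (simp add: power2_sum)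
      finally show ?thesis .
    qed
    then show "AE x in unit_measure. norm ((norm (f x + g x))\<^sup>2)
        \<le> norm (2 * (norm (f x))\<^sup>2 + 2 * (norm (g x))\<^sup>2)"
      by (auto intro!: AE_I2)
  qed measurable
  then show ?thesis by (simp add: square_integrable_def)
qed

lemma integrable_mult_cnj:
  assumes "square_integrable f" "square_integrable g"
  shows "integrable unit_measure (\<lambda>x. f x * cnj (g x))"
proof -
  have [measurable]: "f \<in> borel_measurable unit_measure" "g \<in> borel_measurable unit_measure"
    using assms by (auto simp: square_integrable_def)
  have cnj_meas: "(\<lambda>x. cnj (g x)) \<in> borel_measurable unit_measure"
    by (intro borel_measurable_continuous_on[where f=cnj] continuous_intros) measurable
  have "integrable unit_measure (\<lambda>x. (norm (f x))\<^sup>2 + (norm (g x))\<^sup>2)"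
    using assms by (auto simp: square_integrable_def)
  then show ?thesis
  proof (rule Bochner_Integration.integrable_bound)
    have "norm (f x * cnj (g x)) \<le> norm ((norm (f x))\<^sup>2 + (norm (g x))\<^sup>2)" for x
      using sum_squares_bound[of "norm (f x)" "norm (g x)"]
        mult_nonneg_nonneg[of "norm (f x)" "norm (g x)"]
      by (simp add: norm_mult del: mult_nonneg_nonneg)
    then show "AE x in unit_measure.
        norm (f x * cnj (g x)) \<le> norm ((norm (f x))\<^sup>2 + (norm (g x))\<^sup>2)"
      by auto
  qed (use cnj_meas in measurable)
qed

quotient_type l2 = "real \<Rightarrow> complex" / partial: l2_eq
proof (rule part_equivpI)
  show "\<exists>f. l2_eq f f"
    using square_integrable_zero by (auto simp: l2_eq_def)
  show "symp l2_eq"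
    by (auto simp: symp_def l2_eq_def eq_commute)
  show "transp l2_eq"
    unfolding transp_def l2_eq_def
  proof (intro allI impI, elim conjE, intro conjI)
    fix f g h :: "real \<Rightarrow> complex"
    assume "AE x in unit_measure. f x = g x" "AE x in unit_measure. g x = h x"
    then show "AE x in unit_measure. f x = h x" by eventually_elim simp
  qed
qed

lift_definition l2_scale :: "complex \<Rightarrow> l2 \<Rightarrow> l2" is "\<lambda>c f x. c * f x"
  by (auto simp: l2_eq_def square_integrable_scale elim: AE_mp)

lift_definition l2_inner :: "l2 \<Rightarrow> l2 \<Rightarrow> complex"
  is "\<lambda>f g. integral\<^sup>L unit_measure (\<lambda>x. f x * cnj (g x))"
proof -
  fix f f' g g' assume "l2_eq f f'" "l2_eq g g'"
  then show "integral\<^sup>L unit_measure (\<lambda>x. f x * cnj (g x))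
      = integral\<^sup>L unit_measure (\<lambda>x. f' x * cnj (g' x))"
    using integrable_mult_cnj[of f g] integrable_mult_cnj[of f' g']
    by (intro integral_cong_AE) (auto simp: l2_eq_def)
qed

instantiation l2 :: ab_group_add
begin

lift_definition zero_l2 :: l2 is "\<lambda>x. 0"
  by (simp add: l2_eq_def square_integrable_zero)

lift_definition plus_l2 :: "l2 \<Rightarrow> l2 \<Rightarrow> l2" is "\<lambda>f g x. f x + g x"
  by (auto simp: l2_eq_def square_integrable_add)

lift_definition uminus_l2 :: "l2 \<Rightarrow> l2" is "\<lambda>f x. - f x"
  using square_integrable_scale[where c = "-1"] by (auto simp: l2_eq_def)

definition minus_l2 :: "l2 \<Rightarrow> l2 \<Rightarrow> l2" where
  "minus_l2 f g = f + - g"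

instance
proof
  fix a b c :: l2
  show "a + b + c = a + (b + c)"
    by transfer (auto simp: l2_eq_def square_integrable_add add.assoc)
  show "a + b = b + a"
    by transfer (auto simp: l2_eq_def square_integrable_add add.commute)
  show "0 + a = a"
    by transfer (auto simp: l2_eq_def)
  show "- a + a = 0"
    by transfer (auto simp: l2_eq_def square_integrable_zero)
  show "a - b = a + - b"
    by (rule minus_l2_def)
qed

end

interpretation l2: vector_space l2_scale
proof
  fix a b :: complex and x y :: l2
  show "l2_scale a (x + y) = l2_scale a x + l2_scale a y"
    by transfer (auto simp: l2_eq_def square_integrable_add square_integrable_scale distrib_left)
  show "l2_scale (a + b) x = l2_scale a x + l2_scale b x"
    by transfer
      (auto simp: l2_eq_def square_integrable_add square_integrable_scale distrib_right)
  show "l2_scale a (l2_scale b x) = l2_scale (a * b) x"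
    by transfer (auto simp: l2_eq_def square_integrable_scale mult.assoc)
  show "l2_scale 1 x = x"
    by transfer (auto simp: l2_eq_def)
qed

lemma l2_inner_commute: "l2_inner f g = cnj (l2_inner g f)"
proof transfer
  fix f g :: "real \<Rightarrow> complex"
  have "cnj (integral\<^sup>L unit_measure (\<lambda>x. g x * cnj (f x)))
      = integral\<^sup>L unit_measure (\<lambda>x. cnj (g x * cnj (f x)))"
    by (rule Bochner_Integration.integral_cnj[symmetric])
  then show "integral\<^sup>L unit_measure (\<lambda>x. f x * cnj (g x))
      = cnj (integral\<^sup>L unit_measure (\<lambda>x. g x * cnj (f x)))"
    by (simp add: mult.commute)
qed

lemma l2_inner_add_left: "l2_inner (f + g) h = l2_inner f h + l2_inner g h"
  by transfer (simp add: l2_eq_def distrib_right integrable_mult_cnj)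

lemma l2_inner_scale_left: "l2_inner (l2_scale c f) g = c * l2_inner f g"
  by transfer (simp add: mult.assoc)

lemma l2_inner_self_eq_0: "l2_inner f f = 0 \<longleftrightarrow> f = 0"
proof transfer
  fix f assume "l2_eq f f"
  then have f: "square_integrable f" by (simp add: l2_eq_def)
  then have int: "integrable unit_measure (\<lambda>x. (norm (f x))\<^sup>2)"
    by (simp add: square_integrable_def)
  have "integral\<^sup>L unit_measure (\<lambda>x. f x * cnj (f x))
      = complex_of_real (integral\<^sup>L unit_measure (\<lambda>x. (norm (f x))\<^sup>2))"
    by (simp add: complex_norm_square[symmetric] flip: integral_complex_of_real)
  then show "integral\<^sup>L unit_measure (\<lambda>x. f x * cnj (f x)) = 0 \<longleftrightarrow> l2_eq f (\<lambda>x. 0)"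
    using integral_nonneg_eq_0_iff_AE[OF int] f
    by (simp add: l2_eq_def square_integrable_zero)
qed


section \<open>Point spectrum and adjoint\<close>

definition point_spectrum :: "(l2 \<Rightarrow> l2) \<Rightarrow> complex set" where
  "point_spectrum T = {z. \<exists>f. f \<noteq> 0 \<and> T f = l2_scale z f}"

text \<open>
  There is at most one operator with the defining property below, because the inner product is
  definite; for a bounded linear operator it exists by the Riesz representation theorem.
\<close>

definition l2_adjoint :: "(l2 \<Rightarrow> l2) \<Rightarrow> l2 \<Rightarrow> l2" where
  "l2_adjoint T = (THE S. \<forall>f g. l2_inner (T f) g = l2_inner f (S g))"


section \<open>The Cesaro operator\<close>

text \<open>
  The integral does not depend on the representative of the class of \<open>f\<close>, and it converges
  absolutely for \<open>0 < x < 1\<close>, since \<open>1 / (1 - t)\<close> is bounded on \<open>(0, x)\<close>.  The resulting function of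
  \<open>x\<close> is square integrable on \<open>(0, 1)\<close> by Hardy's inequality, so \<open>abs_l2\<close> is only applied to
  functions which represent an element of \<open>l2\<close>.
\<close>

definition cesaro_fun :: "(real \<Rightarrow> complex) \<Rightarrow> real \<Rightarrow> complex" where
  "cesaro_fun f x =
     1 / complex_of_real x *
       integral\<^sup>L (lebesgue_on {0<..<x}) (\<lambda>t. f t / complex_of_real (1 - t))"

definition cesaro :: "l2 \<Rightarrow> l2" where
  "cesaro f = abs_l2 (cesaro_fun (rep_l2 f))"

end

theory Submission
  imports Defs
begin

text \<open>
  The eigenvalue equation \<open>C f = z f\<close> is a first order differential equation.  Let
  \<open>F(x) = \<integral>\<^sub>0\<^sup>x f(t) / (1 - t) dt\<close>, so that \<open>F(x) = z x f(x)\<close> almost everywhere.  If \<open>z = 0\<close>, then \<open>F\<close>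
  vanishes and hence so does its density \<open>f(t) / (1 - t)\<close>.  If \<open>z \<noteq> 0\<close>, the integrand equals
  \<open>F(t) / (z t (1 - t))\<close> almost everywhere; this is continuous, so \<open>F\<close> is differentiable and solves
  \<open>F' = F / (z x (1 - x))\<close>, which forces \<open>F(x) = c (x / (1 - x))\<^bsup>1/z\<^esup>\<close>
  (\<open>eigenfunction_primitive\<close>).  With \<open>a = Re (1/z)\<close> this makes \<open>|f(x)|\<^sup>2\<close> a constant multiple of
  \<open>(x / (1 - x))\<^bsup>2a\<^esup> / x\<^sup>2\<close>.  Integrability at \<open>0\<close> requires \<open>a > 1/2\<close> and integrability at \<open>1\<close>
  requires \<open>a < 1/2\<close> (\<open>odds_power_not_integrable\<close>), so \<open>c = 0\<close> and again \<open>F\<close> vanishes.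

  The adjoint needs no second computation.  Exchanging the order of integration gives
  \<open>(C\<^sup>* g)(t) = (\<integral>\<^sub>t\<^sup>1 g(x) / x dx) / (1 - t)\<close>, and this is \<open>U C U\<close> for the reflection
  \<open>(U f)(x) = f(1 - x)\<close> (\<open>adjoint_cesaro\<close>).  As \<open>U\<close> is a linear involution, an eigenvector \<open>g\<close> of
  \<open>C\<^sup>*\<close> yields the eigenvector \<open>U g\<close> of \<open>C\<close> for the same eigenvalue.

  Both parts rest on the fact that \<open>C\<close> maps square integrable functions to square integrable ones:
  without it the values of \<open>C\<close> would not be classes of the functions which define them, and the
  exchange of integrals could not be justified.  It follows from the Hardy type inequality
  \<open>\<parallel>C f\<parallel> \<le> 2 \<parallel>f\<parallel>\<close> (\<open>hardy_inequality\<close>).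
\<close>

section \<open>Lebesgue measure on the unit interval\<close>

interpretation unit: finite_measure unit_measure
  by (rule finite_measure_lebesgue_on) simp

interpretation unit_pair: pair_sigma_finite unit_measure unit_measure ..

lemma borel_measurable_unit_measure:
  "f \<in> borel_measurable borel \<Longrightarrow> f \<in> borel_measurable unit_measure"
  by (intro measurable_restrict_space1 measurable_completion) simp

lemma ident_unit_measurable [measurable]: "(\<lambda>x. x) \<in> borel_measurable unit_measure"
  by (rule borel_measurable_unit_measure) simp

lemma fst_unit_measurable [measurable]:
  "fst \<in> borel_measurable (unit_measure \<Otimes>\<^sub>M unit_measure)"
  by (rule measurable_compose[OF measurable_fst ident_unit_measurable])

lemma snd_unit_measurable [measurable]:
  "snd \<in> borel_measurable (unit_measure \<Otimes>\<^sub>M unit_measure)"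
  by (rule measurable_compose[OF measurable_snd ident_unit_measurable])

lemma Int_unit_interval_in_sets:
  assumes "A \<in> sets borel"
  shows "A \<inter> {0<..<1} \<in> sets unit_measure"
  using assms by (auto simp: sets_restrict_space)

text \<open>
  Turns an antiderivative, which yields a Henstock-Kurzweil integral over a closed interval, into an
  upper bound for the extended nonnegative integrals below.
\<close>

lemma nn_integral_unit_measure_le:
  fixes g :: "real \<Rightarrow> real"
  assumes g: "(g has_integral I) A" and nonneg: "\<And>x. x \<in> A \<Longrightarrow> 0 \<le> g x"
    and B: "B \<inter> {0<..<1} \<subseteq> A"
  shows "(\<integral>\<^sup>+x. ennreal (g x) * indicator B x \<partial>unit_measure) \<le> ennreal I"
proof -
  have "(\<integral>\<^sup>+x. ennreal (g x) * indicator B x \<partial>unit_measure)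
      = (\<integral>\<^sup>+x. ennreal (g x) * indicator B x * indicator {0<..<1} x \<partial>lborel)"
    by (simp add: nn_integral_restrict_space nn_integral_completion)
  also have "\<dots> \<le> (\<integral>\<^sup>+x. ennreal (g x) * indicator A x \<partial>lborel)"
    using B by (intro nn_integral_mono) (auto simp: indicator_def)
  also have "\<dots> = ennreal I"
    using nonneg g by (rule nn_integral_has_integral_lebesgue')
  finally show ?thesis .
qed

lemma AE_unit_measureE:
  assumes "AE x in unit_measure. P x"
  obtains N where "negligible N" "\<And>x. x \<in> {0<..<1} - N \<Longrightarrow> P x"
proof -
  obtain N where N: "\<And>x. x \<in> space unit_measure - N \<Longrightarrow> P x" "N \<in> null_sets unit_measure"
    using assms by (rule AE_E3) blast
  then have "negligible N"
    by (auto simp: negligible_iff_null_sets null_sets_restrict_space)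
  with N(1) show thesis
    by (intro that) auto
qed

text \<open>
  The reflection \<open>x \<mapsto> 1 - x\<close> preserves the measure on the unit interval and exchanges its two ends.
\<close>

lemma reflect_measurable [measurable]: "(\<lambda>x. 1 - x) \<in> unit_measure \<rightarrow>\<^sub>M unit_measure"
proof (intro measurable_restrict_space3)
  show "(\<lambda>x. 1 - x :: real) \<in> lebesgue \<rightarrow>\<^sub>M lebesgue"
    using lebesgue_affine_measurable[of "\<lambda>_. -1" "1::real"] by simp
qed auto

lemma distr_unit_measure_reflect: "distr unit_measure unit_measure (\<lambda>x. 1 - x) = unit_measure"
proof (rule measure_eqI)
  have T: "(\<lambda>x. 1 - x :: real) \<in> lebesgue \<rightarrow>\<^sub>M lebesgue"
    using lebesgue_affine_measurable[of "\<lambda>_. -1" "1::real"] by simp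
  have leb: "distr lebesgue lebesgue (\<lambda>x. 1 - x :: real) = lebesgue"
    using lebesgue_real_affine[of "-1" 1] by (simp add: density_1)
  fix A assume "A \<in> sets (distr unit_measure unit_measure (\<lambda>x. 1 - x))"
  then have A: "A \<in> sets unit_measure" by simp
  then have A': "A \<in> sets lebesgue" "A \<subseteq> {0<..<1}"
    by (auto simp: sets_restrict_space_iff)
  have "emeasure (distr unit_measure unit_measure (\<lambda>x. 1 - x)) A
      = emeasure unit_measure ((\<lambda>x. 1 - x) -` A \<inter> space unit_measure)"
    using reflect_measurable A by (rule emeasure_distr)
  also have "(\<lambda>x. 1 - x) -` A \<inter> space unit_measure = (\<lambda>x. 1 - x) -` A"
    using A' by auto
  also have "emeasure unit_measure \<dots> = emeasure lebesgue ((\<lambda>x. 1 - x) -` A \<inter> space lebesgue)"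
    using A' by (subst emeasure_restrict_space) auto
  also have "\<dots> = emeasure (distr lebesgue lebesgue (\<lambda>x. 1 - x :: real)) A"
    using T A' by (simp add: emeasure_distr)
  also have "\<dots> = emeasure unit_measure A"
    using A' unfolding leb by (simp add: emeasure_restrict_space)
  finally show "emeasure (distr unit_measure unit_measure (\<lambda>x. 1 - x)) A = emeasure unit_measure A" .
qed simp

lemma integral_reflect_unit:
  fixes f :: "real \<Rightarrow> 'a::{banach, second_countable_topology}"
  assumes "f \<in> borel_measurable unit_measure"
  shows "integral\<^sup>L unit_measure (\<lambda>x. f (1 - x)) = integral\<^sup>L unit_measure f"
  using integral_distr[OF reflect_measurable assms] by (simp add: distr_unit_measure_reflect)

lemma integrable_reflect_unit:
  fixes f :: "real \<Rightarrow> 'a::{banach, second_countable_topology}"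
  assumes "integrable unit_measure f"
  shows "integrable unit_measure (\<lambda>x. f (1 - x))"
  using integrable_distr[OF reflect_measurable, of f] assms by (simp add: distr_unit_measure_reflect)

lemma AE_reflect_unit:
  assumes "AE x in unit_measure. P x"
  shows "AE x in unit_measure. P (1 - x)"
proof -
  have "AE x in distr unit_measure unit_measure (\<lambda>x. 1 - x). P x"
    using assms by (simp only: distr_unit_measure_reflect)
  then show ?thesis
    by (rule AE_distrD[OF reflect_measurable])
qed



section \<open>A Hardy inequality\<close>

text \<open>
  The change of variable \<open>u = x / (1 - x)\<close> maps \<open>(0, 1)\<close> onto \<open>(0, \<infinity>)\<close>.  Here \<open>du = dx / (1 - x)\<^sup>2\<close> and
  \<open>du / u\<^sup>2 = dx / x\<^sup>2\<close>, which are the two measures that the factors \<open>1 / (1 - t)\<close> and \<open>1 / x\<close> of the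
  kernel produce when they are squared.
\<close>

definition odds :: "real \<Rightarrow> real" where
  "odds x = x / (1 - x)"

lemma odds_measurable [measurable]: "odds \<in> borel_measurable borel"
  unfolding odds_def[abs_def] by measurable

lemma odds_pos: "x \<in> {0<..<1} \<Longrightarrow> 0 < odds x"
  by (simp add: odds_def)

text \<open>
  In the variable \<open>u = odds t\<close> this is \<open>\<integral> u\<^bsup>-1/2\<^esup> du = 2 u\<^bsup>1/2\<^esup>\<close>.  The derivative blows up at \<open>0\<close>, but the
  antiderivative is continuous there, which is enough for the fundamental theorem of calculus.
\<close>

lemma sqrt_odds_integral_below:
  assumes "x \<in> {0<..<1}"
  shows "(\<integral>\<^sup>+t. ennreal (1 / ((1 - t)\<^sup>2 * sqrt (odds t))) * indicator {..<x} t \<partial>unit_measure)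
    \<le> ennreal (2 * sqrt (odds x))"
proof (rule nn_integral_unit_measure_le[where A = "{0..x}"])
  have "((\<lambda>t. 1 / ((1 - t)\<^sup>2 * sqrt (odds t))) has_integral 2 * sqrt (odds x) - 2 * sqrt (odds 0)) {0..x}"
  proof (rule fundamental_theorem_of_calculus_interior)
    show "continuous_on {0..x} (\<lambda>t. 2 * sqrt (odds t))"
      using assms unfolding odds_def by (intro continuous_intros) auto
    fix t assume t: "t \<in> {0<..<x}"
    then have "0 < t / (1 - t)" "t < 1" using assms by auto
    then have "0 < odds t" and "(odds has_real_derivative 1 / (1 - t)\<^sup>2) (at t)"
      unfolding odds_def[abs_def]
      by (auto intro!: derivative_eq_intros simp: field_simps power2_eq_square)
    then have "((\<lambda>t. 2 * sqrt (odds t)) has_real_derivative 1 / ((1 - t)\<^sup>2 * sqrt (odds t))) (at t)"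
      by (auto intro!: derivative_eq_intros simp: field_simps)
    then show "((\<lambda>t. 2 * sqrt (odds t)) has_vector_derivative 1 / ((1 - t)\<^sup>2 * sqrt (odds t))) (at t)"
      by (simp add: has_real_derivative_iff_has_vector_derivative)
  qed (use assms in auto)
  then show "((\<lambda>t. 1 / ((1 - t)\<^sup>2 * sqrt (odds t))) has_integral 2 * sqrt (odds x)) {0..x}"
    by (simp add: odds_def)
qed (use assms in \<open>auto simp: odds_def\<close>)

text \<open>
  In the variable \<open>u = odds x\<close> this is \<open>\<integral> u\<^bsup>-3/2\<^esup> du = -2 u\<^bsup>-1/2\<^esup>\<close>, taken up to \<open>u = \<infinity>\<close>.  The
  antiderivative is written as \<open>-2 sqrt (1 / x - 1)\<close>, which extends continuously to \<open>x = 1\<close>.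
\<close>

lemma sqrt_odds_integral_above:
  assumes "t \<in> {0<..<1}"
  shows "(\<integral>\<^sup>+x. ennreal (sqrt (odds x) / x\<^sup>2) * indicator {t<..} x \<partial>unit_measure)
    \<le> ennreal (2 / sqrt (odds t))"
proof (rule nn_integral_unit_measure_le[where A = "{t..1}"])
  have "((\<lambda>x. sqrt (odds x) / x\<^sup>2) has_integral
      - 2 * sqrt (1 / 1 - 1) - (- 2 * sqrt (1 / t - 1))) {t..1}"
  proof (rule fundamental_theorem_of_calculus_interior)
    show "continuous_on {t..1} (\<lambda>x. - 2 * sqrt (1 / x - 1))"
      using assms by (intro continuous_intros) auto
    fix x assume x: "x \<in> {t<..<1}"
    then have x': "0 < x" "x < 1" using assms by auto
    then have pos: "0 < 1 / x - 1" by (simp add: field_simps)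
    have "odds x = 1 / (1 / x - 1)"
      using x' unfolding odds_def by (simp add: field_simps)
    then have eq: "sqrt (odds x) = 1 / sqrt (1 / x - 1)"
      by (simp add: real_sqrt_divide)
    have "((\<lambda>x. - 2 * sqrt (1 / x - 1)) has_real_derivative sqrt (odds x) / x\<^sup>2) (at x)"
      unfolding eq using pos x'
      by (auto intro!: derivative_eq_intros simp: field_simps power2_eq_square)
    then show "((\<lambda>x. - 2 * sqrt (1 / x - 1)) has_vector_derivative sqrt (odds x) / x\<^sup>2) (at x)"
      by (simp add: has_real_derivative_iff_has_vector_derivative)
  qed (use assms in auto)
  moreover have "- 2 * sqrt (1 / 1 - 1) - (- 2 * sqrt (1 / t - 1)) = 2 / sqrt (odds t)"
    using assms unfolding odds_def by (simp add: real_sqrt_divide field_simps)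
  ultimately show "((\<lambda>x. sqrt (odds x) / x\<^sup>2) has_integral 2 / sqrt (odds t)) {t..1}"
    by simp
qed (use assms in \<open>auto simp: odds_def\<close>)

text \<open>
  The Cauchy-Schwarz inequality with the weight \<open>sqrt (odds t)\<close>: the factor without \<open>f\<close> is then
  integrable at \<open>0\<close> and has the closed form of the preceding computation.
\<close>

lemma hardy_pointwise:
  assumes x: "x \<in> {0<..<1}" and [measurable]: "f \<in> borel_measurable unit_measure"
  shows "(\<integral>\<^sup>+t. f t * ennreal (1 / (1 - t)) * indicator {..<x} t \<partial>unit_measure)\<^sup>2
    \<le> (\<integral>\<^sup>+t. (f t)\<^sup>2 * ennreal (sqrt (odds t)) * indicator {..<x} t \<partial>unit_measure)
        * ennreal (2 * sqrt (odds x))"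
proof -
  \<comment> \<open>\<open>u\<close> and \<open>v\<close> split the integrand such that their squares carry the weight and its inverse.\<close>
  define u where "u t = f t * ennreal (sqrt (sqrt (odds t))) * indicator {..<x} t" for t
  define v where "v t = ennreal (1 / ((1 - t) * sqrt (sqrt (odds t)))) * indicator {..<x} t" for t
  have [measurable]: "u \<in> borel_measurable unit_measure" "v \<in> borel_measurable unit_measure"
    unfolding u_def[abs_def] v_def[abs_def] by measurable
  have prod: "f t * ennreal (1 / (1 - t)) * indicator {..<x} t = u t * v t"
    and u2: "(u t)\<^sup>2 = (f t)\<^sup>2 * ennreal (sqrt (odds t)) * indicator {..<x} t"
    and v2: "(v t)\<^sup>2 = ennreal (1 / ((1 - t)\<^sup>2 * sqrt (odds t))) * indicator {..<x} t"
    if t: "t \<in> space unit_measure" for t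
  proof -
    have t': "0 < t" "t < 1" "0 < odds t" using t odds_pos by auto
    have "ennreal (1 / (1 - t))
        = ennreal (sqrt (sqrt (odds t))) * ennreal (1 / ((1 - t) * sqrt (sqrt (odds t))))"
      using t' by (simp flip: ennreal_mult)
    then show "f t * ennreal (1 / (1 - t)) * indicator {..<x} t = u t * v t"
      unfolding u_def v_def by (auto simp: indicator_def mult.assoc)
    show "(u t)\<^sup>2 = (f t)\<^sup>2 * ennreal (sqrt (odds t)) * indicator {..<x} t"
      using t' unfolding u_def by (auto simp: indicator_def power_mult_distrib ennreal_power)
    show "(v t)\<^sup>2 = ennreal (1 / ((1 - t)\<^sup>2 * sqrt (odds t))) * indicator {..<x} t"
      using t' unfolding v_def
      by (auto simp: indicator_def power_mult_distrib ennreal_power power_divide)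
  qed
  have "(\<integral>\<^sup>+t. f t * ennreal (1 / (1 - t)) * indicator {..<x} t \<partial>unit_measure)\<^sup>2
      = (\<integral>\<^sup>+t. u t * v t \<partial>unit_measure)\<^sup>2"
    using prod by (intro arg_cong[where f = "\<lambda>y. y\<^sup>2"] nn_integral_cong)
  also have "\<dots> \<le> (\<integral>\<^sup>+t. (u t)\<^sup>2 \<partial>unit_measure) * (\<integral>\<^sup>+t. (v t)\<^sup>2 \<partial>unit_measure)"
    by (rule Cauchy_Schwarz_nn_integral) measurable
  also have "(\<integral>\<^sup>+t. (u t)\<^sup>2 \<partial>unit_measure)
      = (\<integral>\<^sup>+t. (f t)\<^sup>2 * ennreal (sqrt (odds t)) * indicator {..<x} t \<partial>unit_measure)"
    using u2 by (rule nn_integral_cong)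
  also have "(\<integral>\<^sup>+t. (v t)\<^sup>2 \<partial>unit_measure)
      = (\<integral>\<^sup>+t. ennreal (1 / ((1 - t)\<^sup>2 * sqrt (odds t))) * indicator {..<x} t \<partial>unit_measure)"
    using v2 by (rule nn_integral_cong)
  finally show ?thesis
    using sqrt_odds_integral_below[OF x] by (meson mult_left_mono order_trans zero_le)
qed

text \<open>
  Schur's test for the kernel of \<open>C\<close>: square, bound pointwise, and exchange the integrals.  The inner
  integral over \<open>x\<close> then cancels the weight \<open>sqrt (odds t)\<close> and leaves the constant \<open>2 * 2\<close>.  Working
  with extended nonnegative integrals postpones every question of integrability.
\<close>

lemma hardy_inequality:
  assumes [measurable]: "f \<in> borel_measurable unit_measure"
  shows "(\<integral>\<^sup>+x. (ennreal (1 / x) *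
        (\<integral>\<^sup>+t. f t * ennreal (1 / (1 - t)) * indicator {..<x} t \<partial>unit_measure))\<^sup>2 \<partial>unit_measure)
    \<le> 4 * (\<integral>\<^sup>+t. (f t)\<^sup>2 \<partial>unit_measure)"
proof -
  define K where "K x t = (f t)\<^sup>2 * ennreal (sqrt (odds t)) *
      (ennreal (2 * sqrt (odds x) / x\<^sup>2) * indicator {t<..} x)" for x t
  have [measurable]: "(\<lambda>(x, t). K x t) \<in> borel_measurable (unit_measure \<Otimes>\<^sub>M unit_measure)"
    unfolding K_def indicator_def greaterThan_iff by measurable
  have "(\<integral>\<^sup>+x. (ennreal (1 / x) *
        (\<integral>\<^sup>+t. f t * ennreal (1 / (1 - t)) * indicator {..<x} t \<partial>unit_measure))\<^sup>2 \<partial>unit_measure)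
      \<le> (\<integral>\<^sup>+x. (\<integral>\<^sup>+t. K x t \<partial>unit_measure) \<partial>unit_measure)"
  proof (rule nn_integral_mono)
    fix x assume "x \<in> space unit_measure"
    then have x: "x \<in> {0<..<1}" by simp
    have "(ennreal (1 / x) *
        (\<integral>\<^sup>+t. f t * ennreal (1 / (1 - t)) * indicator {..<x} t \<partial>unit_measure))\<^sup>2
      \<le> (ennreal (1 / x))\<^sup>2 *
        ((\<integral>\<^sup>+t. (f t)\<^sup>2 * ennreal (sqrt (odds t)) * indicator {..<x} t \<partial>unit_measure)
        * ennreal (2 * sqrt (odds x)))"
      unfolding power_mult_distrib using hardy_pointwise[OF x assms] by (rule mult_left_mono) simp
    also have "\<dots> = (\<integral>\<^sup>+t. (f t)\<^sup>2 * ennreal (sqrt (odds t)) * indicator {..<x} t \<partial>unit_measure)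
        * ennreal (2 * sqrt (odds x) / x\<^sup>2)"
    proof -
      have "ennreal (2 * sqrt (odds x) / x\<^sup>2) = (ennreal (1 / x))\<^sup>2 * ennreal (2 * sqrt (odds x))"
        using x odds_pos[OF x] by (simp add: ennreal_power power_divide flip: ennreal_mult)
      then show ?thesis by (simp add: ac_simps)
    qed
    also have "\<dots> = (\<integral>\<^sup>+t. (f t)\<^sup>2 * ennreal (sqrt (odds t)) * indicator {..<x} t
        * ennreal (2 * sqrt (odds x) / x\<^sup>2) \<partial>unit_measure)"
      by (rule nn_integral_multc[symmetric]) measurable
    also have "\<dots> = (\<integral>\<^sup>+t. K x t \<partial>unit_measure)"
      unfolding K_def by (rule nn_integral_cong) (auto simp: indicator_def)
    finally show "(ennreal (1 / x) *
        (\<integral>\<^sup>+t. f t * ennreal (1 / (1 - t)) * indicator {..<x} t \<partial>unit_measure))\<^sup>2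
      \<le> (\<integral>\<^sup>+t. K x t \<partial>unit_measure)" .
  qed
  also have "\<dots> = (\<integral>\<^sup>+t. (\<integral>\<^sup>+x. K x t \<partial>unit_measure) \<partial>unit_measure)"
    by (rule unit_pair.Fubini'[symmetric]) measurable
  also have "\<dots> \<le> (\<integral>\<^sup>+t. 4 * (f t)\<^sup>2 \<partial>unit_measure)"
  proof (rule nn_integral_mono)
    fix t assume "t \<in> space unit_measure"
    then have t: "t \<in> {0<..<1}" by simp
    have "(\<integral>\<^sup>+x. K x t \<partial>unit_measure)
        = (f t)\<^sup>2 * ennreal (sqrt (odds t)) *
          (\<integral>\<^sup>+x. 2 * (ennreal (sqrt (odds x) / x\<^sup>2) * indicator {t<..} x) \<partial>unit_measure)"
      unfolding K_def
      by (subst nn_integral_cmult[symmetric])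
         (auto intro!: nn_integral_cong simp: indicator_def ennreal_mult'' simp flip: ennreal_numeral ennreal_mult')
    also have "(\<integral>\<^sup>+x. 2 * (ennreal (sqrt (odds x) / x\<^sup>2) * indicator {t<..} x) \<partial>unit_measure)
        = 2 * (\<integral>\<^sup>+x. ennreal (sqrt (odds x) / x\<^sup>2) * indicator {t<..} x \<partial>unit_measure)"
      by (rule nn_integral_cmult) measurable
    also have "(f t)\<^sup>2 * ennreal (sqrt (odds t)) * \<dots>
        \<le> (f t)\<^sup>2 * ennreal (sqrt (odds t)) * (2 * ennreal (2 / sqrt (odds t)))"
      using sqrt_odds_integral_above[OF t] by (intro mult_left_mono) auto
    also have "\<dots> = (f t)\<^sup>2 * (ennreal (sqrt (odds t)) * (ennreal 2 * ennreal (2 / sqrt (odds t))))"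
      by (simp add: mult.assoc)
    also have "\<dots> = 4 * (f t)\<^sup>2"
      using odds_pos[OF t] by (simp flip: ennreal_mult del: ennreal_numeral) (simp add: mult.commute)
    finally show "(\<integral>\<^sup>+x. K x t \<partial>unit_measure) \<le> 4 * (f t)\<^sup>2" .
  qed
  also have "\<dots> = 4 * (\<integral>\<^sup>+t. (f t)\<^sup>2 \<partial>unit_measure)"
    by (rule nn_integral_cmult) measurable
  finally show ?thesis .
qed

section \<open>The Cesaro integral of a square integrable function\<close>

lemma square_integrable_measurable:
  "square_integrable f \<Longrightarrow> f \<in> borel_measurable unit_measure"
  by (simp add: square_integrable_def)

lemma square_integrable_imp_integrable:
  assumes "square_integrable f"
  shows "integrable unit_measure f"
  using integrable_mult_cnj[OF assms, of "\<lambda>_. 1"] by (simp add: square_integrable_def)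

text \<open>
  Away from \<open>1\<close> the factor \<open>1 / (1 - t)\<close> is bounded by \<open>1 / (1 - b)\<close>, and \<open>f\<close> is integrable since the
  interval has finite measure.
\<close>

lemma integrable_cesaro_integrand:
  assumes f: "square_integrable f" and b: "b < 1"
  shows "integrable unit_measure (\<lambda>t. indicator {..<b} t *\<^sub>R (f t / complex_of_real (1 - t)))"
proof (rule Bochner_Integration.integrable_bound)
  have [measurable]: "f \<in> borel_measurable unit_measure"
    using f by (rule square_integrable_measurable)
  show "integrable unit_measure (\<lambda>t. norm (f t) / (1 - b))"
    using square_integrable_imp_integrable[OF f] by simp
  show "(\<lambda>t. indicator {..<b} t *\<^sub>R (f t / complex_of_real (1 - t))) \<in> borel_measurable unit_measure"
    by measurable
  show "AE t in unit_measure. norm (indicator {..<b} t *\<^sub>R (f t / complex_of_real (1 - t)))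
      \<le> norm (norm (f t) / (1 - b))"
  proof (rule AE_I2)
    fix t :: real
    have "norm (f t) / norm (complex_of_real (1 - t)) \<le> norm (f t) / (1 - b)" if "t < b"
      using b that by (intro divide_left_mono) (auto simp del: of_real_diff)
    then show "norm (indicator {..<b} t *\<^sub>R (f t / complex_of_real (1 - t)))
        \<le> norm (norm (f t) / (1 - b))"
      using b by (simp add: indicator_def norm_divide del: of_real_diff)
  qed
qed

lemma lebesgue_on_initial:
  assumes "x \<le> 1"
  shows "lebesgue_on {0<..<x} = restrict_space unit_measure {..<x}"
proof -
  have "{0<..<1} \<inter> {..<x} = {0<..<x}" using assms by auto
  then show ?thesis
    by (simp add: restrict_restrict_space)
qed

lemma initial_in_sets: "{..<x} \<inter> space unit_measure \<in> sets unit_measure"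
  using Int_unit_interval_in_sets[of "{..<x}"] by simp

text \<open>
  Writing the integral over \<open>(0, x)\<close> as one over the fixed interval \<open>(0, 1)\<close> with an indicator makes
  the theorems on product measures applicable.
\<close>

lemma cesaro_fun_eq:
  assumes "x \<in> {0<..<1}"
  shows "cesaro_fun f x =
    integral\<^sup>L unit_measure (\<lambda>t. indicator {..<x} t *\<^sub>R (f t / complex_of_real (1 - t)))
      / complex_of_real x"
proof -
  have "lebesgue_on {0<..<x} = restrict_space unit_measure {..<x}"
    using assms by (intro lebesgue_on_initial) simp
  then show ?thesis
    unfolding cesaro_fun_def by (simp only: integral_restrict_space[OF initial_in_sets]) simp
qed

lemma cesaro_fun_cong:
  assumes "f \<in> borel_measurable unit_measure" "g \<in> borel_measurable unit_measure"
    and ae: "AE t in unit_measure. f t = g t" and x: "x \<in> {0<..<1}"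
  shows "cesaro_fun f x = cesaro_fun g x"
proof -
  note [measurable] = assms(1,2)
  show ?thesis
    unfolding cesaro_fun_eq[OF x]
    using ae by (intro arg_cong2[where f = "(/)"] integral_cong_AE refl) (measurable, auto)
qed

lemma cesaro_fun_measurable:
  assumes [measurable]: "f \<in> borel_measurable unit_measure"
  shows "cesaro_fun f \<in> borel_measurable unit_measure"
proof -
  define F where "F x = integral\<^sup>L unit_measure
      (\<lambda>t. indicator {..<x} t *\<^sub>R (f t / complex_of_real (1 - t))) / complex_of_real x" for x
  have "F \<in> borel_measurable unit_measure"
    unfolding F_def[abs_def] indicator_def lessThan_iff by measurable
  moreover have "F \<in> borel_measurable unit_measure \<longleftrightarrow> cesaro_fun f \<in> borel_measurable unit_measure"
    by (rule measurable_cong) (simp add: cesaro_fun_eq F_def)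
  ultimately show ?thesis by simp
qed

lemma square_integrable_cesaro_fun:
  assumes f: "square_integrable f"
  shows "square_integrable (cesaro_fun f)"
proof -
  have [measurable]: "f \<in> borel_measurable unit_measure"
    using f by (rule square_integrable_measurable)
  note [measurable] = cesaro_fun_measurable[of f]
  have bound: "ennreal (norm (cesaro_fun f x)) \<le> ennreal (1 / x) *
      (\<integral>\<^sup>+t. ennreal (norm (f t)) * ennreal (1 / (1 - t)) * indicator {..<x} t \<partial>unit_measure)"
    if "x \<in> space unit_measure" for x
  proof -
    have x: "x \<in> {0<..<1}" using that by simp
    have "ennreal (norm (cesaro_fun f x)) = ennreal (1 / x) *
        ennreal (norm (integral\<^sup>L unit_measure (\<lambda>t. indicator {..<x} t *\<^sub>R (f t / complex_of_real (1 - t)))))"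
      using x by (simp add: cesaro_fun_eq[OF x] norm_divide flip: ennreal_mult)
    also have "\<dots> \<le> ennreal (1 / x) *
        (\<integral>\<^sup>+t. ennreal (norm (indicator {..<x} t *\<^sub>R (f t / complex_of_real (1 - t)))) \<partial>unit_measure)"
      using x by (intro mult_left_mono integral_norm_bound_ennreal integrable_cesaro_integrand f) auto
    also have "(\<integral>\<^sup>+t. ennreal (norm (indicator {..<x} t *\<^sub>R (f t / complex_of_real (1 - t)))) \<partial>unit_measure)
      = (\<integral>\<^sup>+t. ennreal (norm (f t)) * ennreal (1 / (1 - t)) * indicator {..<x} t \<partial>unit_measure)"
      by (rule nn_integral_cong)
         (auto simp: indicator_def norm_divide simp del: of_real_diff simp flip: ennreal_mult)
    finally show ?thesis .
  qed
  have "(\<integral>\<^sup>+x. ennreal (norm ((norm (cesaro_fun f x))\<^sup>2)) \<partial>unit_measure)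
      = (\<integral>\<^sup>+x. (ennreal (norm (cesaro_fun f x)))\<^sup>2 \<partial>unit_measure)"
    by (simp add: ennreal_power)
  also have "\<dots> \<le> (\<integral>\<^sup>+x. (ennreal (1 / x) *
      (\<integral>\<^sup>+t. ennreal (norm (f t)) * ennreal (1 / (1 - t)) * indicator {..<x} t \<partial>unit_measure))\<^sup>2
        \<partial>unit_measure)"
    by (intro nn_integral_mono power_mono bound) auto
  also have "\<dots> \<le> 4 * (\<integral>\<^sup>+t. (ennreal (norm (f t)))\<^sup>2 \<partial>unit_measure)"
    by (rule hardy_inequality) measurable
  also have "\<dots> = 4 * (\<integral>\<^sup>+t. ennreal (norm ((norm (f t))\<^sup>2)) \<partial>unit_measure)"
    by (simp add: ennreal_power)
  also have "\<dots> < \<infinity>"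
    using f by (simp add: square_integrable_def integrable_iff_bounded ennreal_mult_less_top)
  finally have "integrable unit_measure (\<lambda>x. (norm (cesaro_fun f x))\<^sup>2)"
    by (intro integrableI_bounded) simp_all
  then show ?thesis
    by (simp add: square_integrable_def)
qed

section \<open>Classes of square integrable functions\<close>

lemma l2_eq_refl: "square_integrable f \<Longrightarrow> l2_eq f f"
  by (simp add: l2_eq_def)

lemma rep_abs_l2: "square_integrable f \<Longrightarrow> l2_eq (rep_l2 (abs_l2 f)) f"
  by (rule Quotient3_rep_abs[OF Quotient3_l2 l2_eq_refl])

lemma abs_l2_eq_iff:
  assumes "square_integrable f" "square_integrable g"
  shows "abs_l2 f = abs_l2 g \<longleftrightarrow> (AE x in unit_measure. f x = g x)"
  using Quotient3_rel[OF Quotient3_l2, of f g] assms by (auto simp: l2_eq_def)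

lemma l2_cases:
  obtains f where "square_integrable f" "h = abs_l2 f"
  using Quotient3_abs_rep[OF Quotient3_l2, of h] Quotient3_rep_reflp[OF Quotient3_l2, of h]
  by (metis l2_eq_def)

text \<open>
  Allows \<open>C\<close> to be computed on any representative: the integral does not see null sets, and the
  function it defines is square integrable, hence represents a class.
\<close>

lemma cesaro_abs_l2:
  assumes f: "square_integrable f"
  shows "cesaro (abs_l2 f) = abs_l2 (cesaro_fun f)"
proof -
  have eq: "l2_eq (rep_l2 (abs_l2 f)) f"
    using f by (rule rep_abs_l2)
  then have rep: "square_integrable (rep_l2 (abs_l2 f))"
    and "AE t in unit_measure. rep_l2 (abs_l2 f) t = f t"
    by (simp_all add: l2_eq_def)
  then have "cesaro_fun (rep_l2 (abs_l2 f)) x = cesaro_fun f x" if "x \<in> {0<..<1}" for x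
    using that f by (intro cesaro_fun_cong) (auto intro: square_integrable_measurable)
  then show ?thesis
    unfolding cesaro_def
    using rep f by (subst abs_l2_eq_iff) (auto intro!: square_integrable_cesaro_fun AE_I2)
qed

lemma zero_eq_abs_l2: "0 = abs_l2 (\<lambda>x. 0)"
  by (simp add: zero_l2_def)

lemma square_integrable_reflect:
  assumes "square_integrable f"
  shows "square_integrable (\<lambda>x. f (1 - x))"
proof -
  have [measurable]: "f \<in> borel_measurable unit_measure"
    using assms by (rule square_integrable_measurable)
  have "(\<lambda>x. f (1 - x)) \<in> borel_measurable unit_measure"
    by measurable
  then show ?thesis
    using assms integrable_reflect_unit[of "\<lambda>x. (norm (f x))\<^sup>2"]
    by (simp add: square_integrable_def)
qed

lift_definition l2_reflect :: "l2 \<Rightarrow> l2" is "\<lambda>f x. f (1 - x)"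
  by (simp add: l2_eq_def square_integrable_reflect)
     (rule AE_reflect_unit[where P = "\<lambda>x. f x = g x" for f g], blast)

lemma l2_reflect_reflect: "l2_reflect (l2_reflect f) = f"
  by transfer (simp add: l2_eq_def)

lemma l2_reflect_zero: "l2_reflect 0 = 0"
  by transfer (simp add: l2_eq_def square_integrable_zero)

lemma l2_reflect_scale: "l2_reflect (l2_scale c f) = l2_scale c (l2_reflect f)"
  by transfer (auto simp: l2_eq_def intro: square_integrable_reflect square_integrable_scale)

lemma l2_reflect_abs_l2:
  "square_integrable f \<Longrightarrow> l2_reflect (abs_l2 f) = abs_l2 (\<lambda>x. f (1 - x))"
  by (rule l2_reflect.abs_eq) (rule l2_eq_refl)

lemma l2_inner_abs_l2:
  assumes "square_integrable f" "square_integrable g"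
  shows "l2_inner (abs_l2 f) (abs_l2 g) = integral\<^sup>L unit_measure (\<lambda>x. f x * cnj (g x))"
  using assms by (simp add: l2_inner.abs_eq l2_eq_refl)

section \<open>The adjoint\<close>

text \<open>
  The function obtained by conjugating \<open>C\<close> with the reflection: integration over \<open>(0, 1 - t)\<close> turns
  into integration over \<open>(t, 1)\<close>, and the factors \<open>1 / x\<close> and \<open>1 / (1 - t)\<close> of the kernel change places.
\<close>

lemma cesaro_fun_reflect:
  assumes [measurable]: "g \<in> borel_measurable unit_measure" and t: "t \<in> {0<..<1}"
  shows "cesaro_fun (\<lambda>x. g (1 - x)) (1 - t) =
    integral\<^sup>L unit_measure (\<lambda>x. indicator {t<..} x *\<^sub>R (g x / complex_of_real x))
      / complex_of_real (1 - t)"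
proof -
  have "integral\<^sup>L unit_measure (\<lambda>s. indicator {..<1 - t} s *\<^sub>R (g (1 - s) / complex_of_real (1 - s)))
      = integral\<^sup>L unit_measure (\<lambda>s. indicator {t<..} (1 - s) *\<^sub>R (g (1 - s) / complex_of_real (1 - s)))"
    by (rule Bochner_Integration.integral_cong) (auto simp: indicator_def)
  also have "\<dots> = integral\<^sup>L unit_measure (\<lambda>x. indicator {t<..} x *\<^sub>R (g x / complex_of_real x))"
    by (rule integral_reflect_unit) measurable
  finally show ?thesis
    using t by (subst cesaro_fun_eq) simp_all
qed

text \<open>
  Both sides are iterated integrals of the same kernel over the triangle \<open>t < x\<close>.  The kernel is
  absolutely integrable there because the integral of its modulus along a row is
  \<open>(C |f|)(x) |g(x)|\<close>, a product of two square integrable functions.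
\<close>

lemma cesaro_fun_adjoint:
  assumes f: "square_integrable f" and g: "square_integrable g"
  shows "integral\<^sup>L unit_measure (\<lambda>x. cesaro_fun f x * cnj (g x)) =
    integral\<^sup>L unit_measure (\<lambda>t. f t * cnj (cesaro_fun (\<lambda>x. g (1 - x)) (1 - t)))"
proof -
  have [measurable]: "f \<in> borel_measurable unit_measure" "g \<in> borel_measurable unit_measure"
    using f g by (auto intro: square_integrable_measurable)
  have cnj_g [measurable]: "(\<lambda>x. cnj (g x)) \<in> borel_measurable unit_measure"
    by (intro borel_measurable_continuous_on[where f=cnj] continuous_intros) measurable
  define k where "k x t =
    (indicator {..<x} t *\<^sub>R (f t / complex_of_real (1 - t))) * (cnj (g x) / complex_of_real x)" for x t
  have [measurable]: "(\<lambda>(x, t). k x t) \<in> borel_measurable (unit_measure \<Otimes>\<^sub>M unit_measure)"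
    unfolding k_def indicator_def lessThan_iff by measurable
  have k_row: "integrable unit_measure (k x)" if "x \<in> {0<..<1}" for x
    unfolding k_def[abs_def] using that
    by (intro Bochner_Integration.integrable_mult_left integrable_cesaro_integrand f) auto
  \<comment> \<open>Integrability of the kernel is reduced to the operator applied to \<open>|f|\<close>.\<close>
  define a where "a t = complex_of_real (norm (f t))" for t
  have a: "square_integrable a"
    using f by (simp add: square_integrable_def a_def[abs_def])
  have norm_row: "(\<integral>t. norm (k x t) \<partial>unit_measure) = norm (cesaro_fun a x * cnj (g x))"
    if x: "x \<in> {0<..<1}" for x
  proof -
    define I where "I = (\<integral>t. indicator {..<x} t *\<^sub>R (norm (f t) / (1 - t)) \<partial>unit_measure)"
    have "0 \<le> I"
      unfolding I_def by (rule integral_nonneg_AE) (auto simp: indicator_def)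
    have "(\<integral>t. indicator {..<x} t *\<^sub>R (a t / complex_of_real (1 - t)) \<partial>unit_measure)
        = (\<integral>t. complex_of_real (indicator {..<x} t *\<^sub>R (norm (f t) / (1 - t))) \<partial>unit_measure)"
      by (rule Bochner_Integration.integral_cong) (auto simp: a_def indicator_def)
    also have "\<dots> = complex_of_real I"
      unfolding I_def by (rule integral_complex_of_real)
    finally have ca: "cesaro_fun a x = complex_of_real I / complex_of_real x"
      by (simp add: cesaro_fun_eq[OF x])
    have "(\<integral>t. norm (k x t) \<partial>unit_measure)
        = (\<integral>t. (indicator {..<x} t *\<^sub>R (norm (f t) / (1 - t))) * (norm (g x) / x) \<partial>unit_measure)"
      unfolding k_def using x
      by (intro Bochner_Integration.integral_cong)
         (auto simp: indicator_def norm_mult norm_divide simp del: of_real_diff)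
    also have "\<dots> = I * (norm (g x) / x)"
      unfolding I_def by (rule Bochner_Integration.integral_mult_left_zero)
    also have "\<dots> = norm (cesaro_fun a x * cnj (g x))"
      using x \<open>0 \<le> I\<close> by (simp add: ca norm_mult norm_divide)
    finally show ?thesis .
  qed
  have "integrable unit_measure (\<lambda>x. norm (cesaro_fun a x * cnj (g x)))"
    by (intro integrable_norm integrable_mult_cnj square_integrable_cesaro_fun a g)
  then have "integrable unit_measure (\<lambda>x. \<integral>t. norm (k x t) \<partial>unit_measure)"
    by (rule Bochner_Integration.integrable_cong[THEN iffD2, rotated 2]) (simp_all add: norm_row)
  then have int: "integrable (unit_measure \<Otimes>\<^sub>M unit_measure) (\<lambda>(x, t). k x t)"
    by (intro unit_pair.Fubini_integrable) (auto intro!: AE_I2 k_row)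
  have row: "integral\<^sup>L unit_measure (k x) = cesaro_fun f x * cnj (g x)" if x: "x \<in> {0<..<1}" for x
    unfolding k_def[abs_def] cesaro_fun_eq[OF x]
    by (subst Bochner_Integration.integral_mult_left_zero) simp
  have col: "(\<integral>x. k x t \<partial>unit_measure) = f t * cnj (cesaro_fun (\<lambda>x. g (1 - x)) (1 - t))"
    if t: "t \<in> {0<..<1}" for t
  proof -
    have "(\<integral>x. k x t \<partial>unit_measure) = (\<integral>x. f t / complex_of_real (1 - t) *
        cnj (indicator {t<..} x *\<^sub>R (g x / complex_of_real x)) \<partial>unit_measure)"
      unfolding k_def by (rule Bochner_Integration.integral_cong) (auto simp: indicator_def)
    also have "\<dots> = f t / complex_of_real (1 - t) *
        cnj (\<integral>x. indicator {t<..} x *\<^sub>R (g x / complex_of_real x) \<partial>unit_measure)"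
      by (simp only: Bochner_Integration.integral_mult_right_zero Bochner_Integration.integral_cnj)
    also have "\<dots> = f t * cnj (cesaro_fun (\<lambda>x. g (1 - x)) (1 - t))"
      using t by (simp add: cesaro_fun_reflect)
    finally show ?thesis .
  qed
  have "integral\<^sup>L unit_measure (\<lambda>x. cesaro_fun f x * cnj (g x))
      = (\<integral>x. (\<integral>t. k x t \<partial>unit_measure) \<partial>unit_measure)"
    by (rule Bochner_Integration.integral_cong) (simp_all add: row)
  also have "\<dots> = (\<integral>t. (\<integral>x. k x t \<partial>unit_measure) \<partial>unit_measure)"
    using unit_pair.Fubini_integral[OF int] by simp
  also have "\<dots> = integral\<^sup>L unit_measure (\<lambda>t. f t * cnj (cesaro_fun (\<lambda>x. g (1 - x)) (1 - t)))"
    by (rule Bochner_Integration.integral_cong) (simp_all add: col)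
  finally show ?thesis .
qed

text \<open>
  Since the inner product is definite, an operator which satisfies the defining identity of the
  adjoint is the only one, so it is selected by the definite description.
\<close>

lemma l2_adjoint_eqI:
  assumes "\<And>f g. l2_inner (T f) g = l2_inner f (S g)"
  shows "l2_adjoint T = S"
  unfolding l2_adjoint_def
proof (rule the_equality)
  show "\<forall>f g. l2_inner (T f) g = l2_inner f (S g)"
    using assms by blast
  fix S' assume S': "\<forall>f g. l2_inner (T f) g = l2_inner f (S' g)"
  show "S' = S"
  proof
    fix g
    define d where "d = S' g - S g"
    have "l2_inner d (S' g) = l2_inner d (S g)"
      using assms S' by metis
    then have "l2_inner (S' g) d = l2_inner (S g) d"
      by (metis l2_inner_commute)
    moreover have "l2_inner (S' g) d = l2_inner d d + l2_inner (S g) d"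
      by (simp add: d_def flip: l2_inner_add_left)
    ultimately have "d = 0"
      by (simp add: l2_inner_self_eq_0)
    then show "S' g = S g"
      by (simp add: d_def)
  qed
qed

lemma adjoint_cesaro: "l2_adjoint cesaro = (\<lambda>g. l2_reflect (cesaro (l2_reflect g)))"
proof (rule l2_adjoint_eqI)
  fix f g :: l2
  obtain f' g' where f': "square_integrable f'" "f = abs_l2 f'"
    and g': "square_integrable g'" "g = abs_l2 g'"
    using l2_cases by metis
  then show "l2_inner (cesaro f) g = l2_inner f (l2_reflect (cesaro (l2_reflect g)))"
    by (simp add: l2_reflect_abs_l2 cesaro_abs_l2 l2_inner_abs_l2 square_integrable_reflect
        square_integrable_cesaro_fun cesaro_fun_adjoint)
qed

text \<open>
  The reflection carries an eigenvector of the adjoint to an eigenvector of \<open>C\<close>.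
\<close>

lemma point_spectrum_adjoint_cesaro: "point_spectrum (l2_adjoint cesaro) \<subseteq> point_spectrum cesaro"
proof
  fix z assume "z \<in> point_spectrum (l2_adjoint cesaro)"
  then obtain f where f: "f \<noteq> 0" "l2_reflect (cesaro (l2_reflect f)) = l2_scale z f"
    by (auto simp: point_spectrum_def adjoint_cesaro)
  have "cesaro (l2_reflect f) = l2_scale z (l2_reflect f)"
    using f(2) by (metis l2_reflect_reflect l2_reflect_scale)
  moreover have "l2_reflect f \<noteq> 0"
    using f(1) by (metis l2_reflect_reflect l2_reflect_zero)
  ultimately show "z \<in> point_spectrum cesaro"
    by (auto simp: point_spectrum_def)
qed

section \<open>Divergence of the candidate eigenfunctions\<close>

text \<open>
  If the integral were a finite \<open>s\<close>, the part of it over \<open>[e, 1/4]\<close> with \<open>e = exp (-(s + 1)) / 4\<close> would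
  already be \<open>s + 1\<close>.
\<close>

lemma nn_integral_inverse_unit:
  "(\<integral>\<^sup>+x. ennreal (1 / x) * indicator {..<1/2} x \<partial>unit_measure) = \<infinity>"
proof (rule ccontr)
  assume "\<not> ?thesis"
  then obtain s where s: "0 \<le> s"
    "(\<integral>\<^sup>+x. ennreal (1 / x) * indicator {..<1/2} x \<partial>unit_measure) = ennreal s"
    by (metis ennreal_cases infinity_ennreal_def)
  define e where "e = exp (- (s + 1)) / 4"
  have e: "0 < e" "e \<le> 1/4"
    using s by (auto simp: e_def)
  have "((\<lambda>x. 1 / x) has_integral ln (1/4) - ln e) {e..1/4}"
  proof (rule fundamental_theorem_of_calculus)
    fix x assume "x \<in> {e..1/4}"
    then have "(ln has_real_derivative 1 / x) (at x within {e..1/4})"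
      using e by (auto intro!: derivative_eq_intros)
    then show "(ln has_vector_derivative 1 / x) (at x within {e..1/4})"
      by (simp add: has_real_derivative_iff_has_vector_derivative)
  qed (use e in auto)
  then have "(\<integral>\<^sup>+x. ennreal (1 / x) * indicator {e..1/4} x \<partial>lborel) = ennreal (ln (1/4) - ln e)"
    using e by (intro nn_integral_has_integral_lebesgue') auto
  also have "ln (1/4) - ln e = s + 1"
    unfolding e_def by (simp add: ln_div)
  finally have "ennreal (s + 1) = (\<integral>\<^sup>+x. ennreal (1 / x) * indicator {e..1/4} x \<partial>lborel)" ..
  also have "\<dots> \<le> (\<integral>\<^sup>+x. ennreal (1 / x) * indicator {..<1/2} x * indicator {0<..<1} x \<partial>lborel)"
    using e by (intro nn_integral_mono) (auto simp: indicator_def)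
  also have "\<dots> = ennreal s"
    by (simp add: nn_integral_restrict_space nn_integral_completion flip: s(2))
  finally show False
    using s by simp
qed

lemma not_integrable_if_ge_inverse:
  assumes ge: "\<And>x. 0 < x \<Longrightarrow> x < 1/2 \<Longrightarrow> 1 / x \<le> u x"
  shows "\<not> integrable unit_measure u"
proof
  assume "integrable unit_measure u"
  then have "(\<integral>\<^sup>+x. ennreal (norm (u x)) \<partial>unit_measure) < \<infinity>"
    by (simp add: integrable_iff_bounded)
  moreover have "(\<integral>\<^sup>+x. ennreal (1 / x) * indicator {..<1/2} x \<partial>unit_measure)
      \<le> (\<integral>\<^sup>+x. ennreal (norm (u x)) \<partial>unit_measure)"
    using ge by (intro nn_integral_mono) (fastforce simp: indicator_def intro!: ennreal_leI)
  ultimately show False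
    by (simp add: nn_integral_inverse_unit)
qed

text \<open>
  For \<open>c = 1\<close> the function is \<open>1 / (x (1 - x))\<close>, which diverges at both ends.  Decreasing the exponent
  makes it larger where \<open>odds x \<le> 1\<close>, that is near \<open>0\<close>; increasing it makes it larger where
  \<open>odds x \<ge> 1\<close>, that is near \<open>1\<close>.  The second case is moved to \<open>0\<close> by reflection.
\<close>

lemma odds_power_not_integrable:
  "\<not> integrable unit_measure (\<lambda>x. exp (c * ln (odds x)) / x\<^sup>2)" (is "\<not> integrable _ ?u")
proof (cases "c \<le> 1")
  case True
  show ?thesis
  proof (rule not_integrable_if_ge_inverse)
    fix x :: real assume x: "0 < x" "x < 1/2"
    then have odds: "0 < odds x" "odds x \<le> 1" by (auto simp: odds_def field_simps)
    then have "ln (odds x) \<le> c * ln (odds x)"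
      using True by (simp add: mult_le_cancel_right1)
    then have "odds x \<le> exp (c * ln (odds x))"
      using odds by (metis exp_le_cancel_iff exp_ln)
    then have "odds x / x\<^sup>2 \<le> ?u x"
      by (rule divide_right_mono) simp
    moreover have "odds x / x\<^sup>2 = (1 / x) * (1 / (1 - x))"
      using x by (simp add: odds_def power2_eq_square)
    moreover have "1 / x * 1 \<le> (1 / x) * (1 / (1 - x))"
      using x by (intro mult_left_mono) auto
    ultimately show "1 / x \<le> ?u x" by simp
  qed
next
  case False
  have "\<not> integrable unit_measure (\<lambda>x. ?u (1 - x))"
  proof (rule not_integrable_if_ge_inverse)
    fix x :: real assume x: "0 < x" "x < 1/2"
    then have odds: "1 \<le> odds (1 - x)" by (auto simp: odds_def field_simps)
    then have "ln (odds (1 - x)) \<le> c * ln (odds (1 - x))"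
      using False by (simp add: mult_le_cancel_right1)
    then have "odds (1 - x) \<le> exp (c * ln (odds (1 - x)))"
      using odds by (metis exp_le_cancel_iff exp_ln zero_less_one less_le_trans)
    then have "odds (1 - x) / (1 - x)\<^sup>2 \<le> ?u (1 - x)"
      by (rule divide_right_mono) simp
    moreover have "odds (1 - x) / (1 - x)\<^sup>2 = (1 / x) * (1 / (1 - x))"
      using x by (simp add: odds_def power2_eq_square)
    moreover have "1 / x * 1 \<le> (1 / x) * (1 / (1 - x))"
      using x by (intro mult_left_mono) auto
    ultimately show "1 / x \<le> ?u (1 - x)" by simp
  qed
  then show ?thesis
    using integrable_reflect_unit[of ?u] by blast
qed

section \<open>Functions with vanishing integrals\<close>

text \<open>
  By Henstock's lemma the Riemann sums of \<open>f\<close> over fine divisions approximate the integrals over the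
  individual pieces with small total error.  As all these integrals vanish, the sum of the norms of
  the terms is small, so \<open>norm f\<close> has integral \<open>0\<close>.
\<close>

lemma AE_zero_if_integrals_zero:
  fixes f :: "real \<Rightarrow> 'a::euclidean_space"
  assumes int: "integrable (lebesgue_on {a..b}) f"
    and zero: "\<And>c d. a \<le> c \<Longrightarrow> c \<le> d \<Longrightarrow> d \<le> b \<Longrightarrow> integral {c..d} f = 0"
  shows "AE x in lebesgue_on {a..b}. f x = 0"
proof -
  have f: "f integrable_on cbox a b"
    using integrable_on_lebesgue_on[OF int] by simp
  have "((\<lambda>x. norm (f x)) has_integral 0) (cbox a b)"
    unfolding has_integral
  proof (intro allI impI)
    fix e :: real assume "0 < e"
    obtain \<gamma> where \<gamma>: "gauge \<gamma>" "\<And>p. p tagged_partial_division_of (cbox a b) \<Longrightarrow> \<gamma> fine p \<Longrightarrow>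
        sum (\<lambda>(x,k). norm (measure lborel k *\<^sub>R f x - integral k f)) p < e"
      by (rule Henstock_lemma[OF f \<open>0 < e\<close>], erule that, blast)
    have small: "norm ((\<Sum>(x, k)\<in>p. measure lborel k *\<^sub>R norm (f x)) - 0) < e"
      if p: "p tagged_division_of (cbox a b)" "\<gamma> fine p" for p
    proof -
      have null: "integral k f = 0" if xk: "(x, k) \<in> p" for x k
      proof -
        obtain c d where k: "k = cbox c d"
          using tagged_division_ofD(4)[OF p(1) xk] by (elim exE)
        have "x \<in> {c..d}" "{c..d} \<subseteq> {a..b}"
          using tagged_division_ofD(2,3)[OF p(1) xk] by (simp_all only: k box_real)
        then have "c \<le> d" "a \<le> c" "d \<le> b"
          by simp_all
        then show ?thesis
          using zero[of c d] by (simp add: k)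
      qed
      have "(\<Sum>(x, k)\<in>p. measure lborel k *\<^sub>R norm (f x))
          = sum (\<lambda>(x,k). norm (measure lborel k *\<^sub>R f x - integral k f)) p"
        by (rule sum.cong) (auto simp: null)
      also have "\<dots> < e"
        using \<gamma>(2) p by (simp add: tagged_division_of_def)
      finally show ?thesis
        by (simp add: sum_nonneg case_prod_beta)
    qed
    show "\<exists>\<gamma>. gauge \<gamma> \<and> (\<forall>p. p tagged_division_of cbox a b \<and> \<gamma> fine p \<longrightarrow>
        norm ((\<Sum>(x, k)\<in>p. measure lborel k *\<^sub>R norm (f x)) - 0) < e)"
      by (intro exI[of _ \<gamma>] conjI allI impI \<gamma>(1), elim conjE, rule small)
  qed
  then have "integral\<^sup>L (lebesgue_on {a..b}) (\<lambda>x. norm (f x)) = 0"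
    using int by (subst lebesgue_integral_eq_integral) (auto intro: integral_unique)
  then show ?thesis
    using int by (subst (asm) integral_nonneg_eq_0_iff_AE) auto
qed

section \<open>Eigenfunctions\<close>

definition cesaro_primitive :: "(real \<Rightarrow> complex) \<Rightarrow> real \<Rightarrow> complex" where
  "cesaro_primitive f x = integral {0..x} (\<lambda>t. f t / complex_of_real (1 - t))"

lemma integrable_integrand_initial:
  assumes "square_integrable f" "b < 1"
  shows "integrable (lebesgue_on {0<..<b}) (\<lambda>t. f t / complex_of_real (1 - t))"
proof -
  have "lebesgue_on {0<..<b} = restrict_space unit_measure {..<b}"
    using assms by (intro lebesgue_on_initial) simp
  then show ?thesis
    using integrable_cesaro_integrand[OF assms]
    by (simp only: integrable_restrict_space[OF initial_in_sets])
qed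

lemma integrand_integrable_on:
  assumes "square_integrable f" "b < 1"
  shows "(\<lambda>t. f t / complex_of_real (1 - t)) integrable_on {0..b}"
proof -
  have "(\<lambda>t. f t / complex_of_real (1 - t)) integrable_on {0<..<b}"
    using integrable_on_lebesgue_on[OF integrable_integrand_initial[OF assms]] by simp
  then show ?thesis
    by (simp only: integrable_on_open_interval_real)
qed

lemma cesaro_fun_eq_primitive:
  assumes "square_integrable f" "x < 1"
  shows "cesaro_fun f x = cesaro_primitive f x / complex_of_real x"
proof -
  have "cesaro_fun f x = 1 / complex_of_real x * integral {0<..<x} (\<lambda>t. f t / complex_of_real (1 - t))"
    unfolding cesaro_fun_def
    by (subst lebesgue_integral_eq_integral[OF integrable_integrand_initial[OF assms]]) simp_all
  then show ?thesis
    by (simp only: cesaro_primitive_def integral_open_interval_real) simp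
qed

lemma continuous_on_primitive:
  assumes "square_integrable f" "b < 1"
  shows "continuous_on {0..b} (cesaro_primitive f)"
  unfolding cesaro_primitive_def[abs_def]
  by (rule indefinite_integral_continuous_1[OF integrand_integrable_on[OF assms]])

lemma isCont_primitive:
  assumes f: "square_integrable f" and x: "x \<in> {0<..<1}"
  shows "isCont (cesaro_primitive f) x"
proof -
  obtain b where "x < b" "b < 1" using x dense[of x 1] by auto
  then show ?thesis
    using x continuous_on_primitive[OF f, of b]
    by (intro continuous_on_interior[where S = "{0..b}"]) auto
qed

text \<open>
  The integrand \<open>f t / (1 - t)\<close> need not be integrable up to \<open>1\<close>, so the vanishing is first shown on
  compact subintervals and then on \<open>(0, 1)\<close> as their countable union.
\<close>

lemma primitive_eq_zero_imp_AE_zero: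
  assumes f: "square_integrable f" and zero: "\<And>x. x \<in> {0<..<1} \<Longrightarrow> cesaro_primitive f x = 0"
  shows "AE x in unit_measure. f x = 0"
proof -
  define p where "p t = f t / complex_of_real (1 - t)" for t
  have compact: "AE t in lebesgue_on {a..b}. p t = 0" if ab: "0 < a" "b < 1" for a b
  proof (rule AE_zero_if_integrals_zero)
    \<comment> \<open>Integrability is known on open intervals starting at \<open>0\<close>; the compact interval is put inside one of them.\<close>
    obtain b' where b': "b < b'" "b' < 1" using dense ab(2) by blast
    have p: "integrable (lebesgue_on {0<..<b'}) p"
      unfolding p_def[abs_def] by (rule integrable_integrand_initial[OF f b'(2)])
    have sub: "{a..b} \<subseteq> {0<..<b'}"
      using ab b' by auto
    then have eq: "lebesgue_on {a..b} = restrict_space (lebesgue_on {0<..<b'}) {a..b}"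
      by (simp add: restrict_restrict_space inf.absorb2)
    have ab_sets: "{a..b} \<in> sets (lebesgue_on {0<..<b'})"
      using sub by (subst sets_restrict_space_iff) auto
    have "{a..b} \<inter> space (lebesgue_on {0<..<b'}) \<in> sets (lebesgue_on {0<..<b'})"
      using sets.Int_space_eq2[OF ab_sets] ab_sets by (rule ssubst)
    from integrable_restrict_space[OF this, THEN iffD2, OF integrable_mult_indicator[OF ab_sets p]]
    show "integrable (lebesgue_on {a..b}) p"
      by (subst eq)
    fix c d assume cd: "a \<le> c" "c \<le> d" "d \<le> b"
    have "integral {0..c} p + integral {c..d} p = integral {0..d} p"
      using cd ab integrand_integrable_on[OF f, of d] unfolding p_def[abs_def]
      by (intro Henstock_Kurzweil_Integration.integral_combine) auto
    moreover have "integral {0..c} p = 0" "integral {0..d} p = 0"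
      using zero[of c] zero[of d] cd ab by (simp_all add: cesaro_primitive_def p_def[abs_def])
    ultimately show "integral {c..d} p = 0" by simp
  qed
  have "AE t in lebesgue. \<forall>n. t \<in> {1 / real (Suc n)..1 - 1 / real (Suc n)} \<longrightarrow> p t = 0"
    unfolding AE_all_countable
  proof
    fix n
    have "AE t in lebesgue_on {1 / real (Suc n)..1 - 1 / real (Suc n)}. p t = 0"
      by (rule compact) auto
    then show "AE t in lebesgue. t \<in> {1 / real (Suc n)..1 - 1 / real (Suc n)} \<longrightarrow> p t = 0"
      by (subst (asm) AE_restrict_space_iff) auto
  qed
  then have "AE t in lebesgue. t \<in> {0<..<1} \<longrightarrow> f t = 0"
  proof eventually_elim
    fix t assume *: "\<forall>n. t \<in> {1 / real (Suc n)..1 - 1 / real (Suc n)} \<longrightarrow> p t = 0"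
    show "t \<in> {0<..<1} \<longrightarrow> f t = 0"
    proof
      assume t: "t \<in> {0<..<1}"
      then obtain n where "inverse (real (Suc n)) < min t (1 - t)"
        using reals_Archimedean[of "min t (1 - t)"] by auto
      then have "p t = 0"
        using *[rule_format, of n] by (auto simp: inverse_eq_divide)
      moreover have "complex_of_real (1 - t) \<noteq> 0"
        using t by (simp del: of_real_diff)
      ultimately show "f t = 0"
        by (simp add: p_def del: of_real_diff)
    qed
  qed
  then show ?thesis
    by (subst AE_restrict_space_iff) auto
qed

text \<open>
  A continuous function which vanishes almost everywhere vanishes, because a nonempty open set is not
  a null set.
\<close>

lemma primitive_eq_zero_if_AE_zero:
  assumes f: "square_integrable f" and ae: "AE x in unit_measure. cesaro_fun f x = 0"
    and x: "x \<in> {0<..<1}"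
  shows "cesaro_primitive f x = 0"
proof (rule ccontr)
  assume nz: "cesaro_primitive f x \<noteq> 0"
  obtain N where N: "negligible N" "\<And>x. x \<in> {0<..<1} - N \<Longrightarrow> cesaro_fun f x = 0"
    using AE_unit_measureE[OF ae] by metis
  define U where "U = {0<..<1} \<inter> cesaro_primitive f -` (- {0})"
  have "continuous_on {0<..<1} (cesaro_primitive f)"
    by (intro continuous_at_imp_continuous_on ballI isCont_primitive f)
  then have "open U"
    unfolding U_def by (intro continuous_open_preimage) auto
  moreover have "U \<subseteq> N"
    using N(2) by (auto simp: U_def cesaro_fun_eq_primitive[OF f])
  then have "negligible U"
    using N(1) negligible_subset by blast
  moreover have "x \<in> U"
    using x nz by (simp add: U_def)
  ultimately show False
    using open_not_negligible by blast
qed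

text \<open>
  The eigenvalue equation allows the integrand \<open>f t / (1 - t)\<close> to be replaced, outside a null set, by
  an expression in the primitive.  That expression is continuous, so the fundamental theorem of
  calculus gives a derivative at every point although \<open>f\<close> is only defined almost everywhere.
\<close>

lemma eigenfunction_primitive_deriv:
  assumes f: "square_integrable f" and z: "z \<noteq> 0"
    and ae: "AE x in unit_measure. cesaro_fun f x = z * f x" and x: "x \<in> {0<..<1}"
  shows "(cesaro_primitive f has_vector_derivative
    cesaro_primitive f x / (z * complex_of_real (x * (1 - x)))) (at x)"
proof -
  obtain N where N: "negligible N" "\<And>x. x \<in> {0<..<1} - N \<Longrightarrow> cesaro_fun f x = z * f x"
    using AE_unit_measureE[OF ae] by metis
  define q where "q t = cesaro_primitive f t / (z * complex_of_real (t * (1 - t)))" for t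
  obtain b where b: "x < b" "b < 1" using x dense[of x 1] by auto
  \<comment> \<open>The point \<open>0\<close> is excluded because the quotient \<open>q\<close> takes the default value \<open>0\<close> there.\<close>
  have neg: "negligible (insert 0 N)"
    using N(1) by simp
  have pq: "q t = f t / complex_of_real (1 - t)" if "t \<in> {0..c} - insert 0 N" "c < 1" for t c
  proof -
    have t: "t \<in> {0<..<1} - N" using that by auto
    then have nz: "complex_of_real t \<noteq> 0" by auto
    have "cesaro_primitive f t / complex_of_real t = z * f t"
      using N(2)[OF t] t by (simp add: cesaro_fun_eq_primitive[OF f])
    then have "cesaro_primitive f t = z * f t * complex_of_real t"
      using nz by (simp add: nonzero_divide_eq_eq)
    then show ?thesis
      using z nz unfolding q_def of_real_mult by simp
  qed
  have F: "cesaro_primitive f c = integral {0..c} q" if "c < 1" for c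
    unfolding cesaro_primitive_def
    using pq that by (intro integral_spike[OF neg]) auto
  have "q integrable_on {0..b}"
    using integrable_spike[OF integrand_integrable_on[OF f b(2)] neg] pq b by metis
  moreover have "isCont q x"
    using x z unfolding q_def[abs_def]
    by (intro continuous_intros isCont_primitive f) auto
  then have "continuous (at x within {0..b} - {}) q"
    by (rule continuous_at_imp_continuous_at_within)
  ultimately have "((\<lambda>u. integral {0..u} q) has_vector_derivative q x) (at x within {0..b} - {})"
    using x b by (intro integral_has_vector_derivative_continuous_at) auto
  moreover have "at x within {0..b} = at x"
    by (rule at_within_interior) (use x b in simp)
  ultimately have "((\<lambda>u. integral {0..u} q) has_vector_derivative q x) (at x)"
    by (simp only: Diff_empty)
  then have "(cesaro_primitive f has_vector_derivative q x) (at x)"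
    by (rule has_vector_derivative_transform_within_open[where S = "{..<1}"]) (use x F in simp_all)
  then show ?thesis
    by (simp add: q_def)
qed

text \<open>
  The differential equation is solved by an integrating factor: \<open>ln (odds x)\<close> has the derivative
  \<open>1 / (x (1 - x))\<close>.
\<close>

lemma eigenfunction_primitive:
  assumes f: "square_integrable f" and z: "z \<noteq> 0"
    and ae: "AE x in unit_measure. cesaro_fun f x = z * f x"
  obtains c where "\<And>x. x \<in> {0<..<1} \<Longrightarrow>
    cesaro_primitive f x = c * exp (1 / z * complex_of_real (ln (odds x)))"
proof -
  define E where "E x = exp (- (1 / z) * complex_of_real (ln (odds x)))" for x
  have "((\<lambda>x. cesaro_primitive f x * E x) has_vector_derivative 0) (at x within {0<..<1})"
    if x: "x \<in> {0<..<1}" for x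
  proof -
    have "0 < odds x" using x by (rule odds_pos)
    moreover have "(odds has_real_derivative 1 / (1 - x)\<^sup>2) (at x)"
      using x unfolding odds_def[abs_def]
      by (auto intro!: derivative_eq_intros simp: field_simps power2_eq_square)
    ultimately have "((\<lambda>x. ln (odds x)) has_real_derivative 1 / odds x * (1 / (1 - x)\<^sup>2)) (at x)"
      by (auto intro!: derivative_eq_intros)
    moreover have "1 / odds x * (1 / (1 - x)\<^sup>2) = 1 / (x * (1 - x))"
      using x by (simp add: odds_def power2_eq_square)
    ultimately have "((\<lambda>x. ln (odds x)) has_real_derivative 1 / (x * (1 - x))) (at x)"
      by (simp only:)
    then have "((\<lambda>x. complex_of_real (ln (odds x))) has_vector_derivative
        complex_of_real (1 / (x * (1 - x)))) (at x)"
      by (rule has_vector_derivative_of_real)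
    then have "((\<lambda>x. - (1 / z) * complex_of_real (ln (odds x))) has_vector_derivative
        - (1 / z) * complex_of_real (1 / (x * (1 - x)))) (at x)"
      by (intro has_vector_derivative_mult_right)
    then have "(E has_vector_derivative
        (- (1 / z) * complex_of_real (1 / (x * (1 - x)))) * E x) (at x)"
      unfolding E_def[abs_def]
      using field_vector_diff_chain_at[OF _ DERIV_exp] by (fastforce simp: o_def)
    from has_vector_derivative_mult[OF eigenfunction_primitive_deriv[OF f z ae x] this]
    have "((\<lambda>x. cesaro_primitive f x * E x) has_vector_derivative 0) (at x)"
      using x z by (simp add: field_simps)
    then show ?thesis
      by (rule has_vector_derivative_at_within)
  qed
  then obtain c where c: "\<And>x. x \<in> {0<..<1} \<Longrightarrow> cesaro_primitive f x * E x = c"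
    using has_vector_derivative_zero_constant[of "{0<..<1}" "\<lambda>x. cesaro_primitive f x * E x"]
    by (metis convex_real_interval(8))
  show thesis
  proof (rule that)
    fix x :: real assume "x \<in> {0<..<1}"
    then have "c = cesaro_primitive f x * E x" by (rule c[symmetric])
    moreover have "E x * exp (1 / z * complex_of_real (ln (odds x))) = 1"
      unfolding E_def by (simp flip: exp_add)
    ultimately show "cesaro_primitive f x = c * exp (1 / z * complex_of_real (ln (odds x)))"
      by (simp only: mult.assoc) simp
  qed
qed

text \<open>
  For \<open>z \<noteq> 0\<close> and a primitive with a constant \<open>c \<noteq> 0\<close>, the square of the modulus of \<open>f\<close> would be a
  multiple of the function shown above not to be integrable.
\<close>

lemma eigenfunction_AE_zero:
  assumes f: "square_integrable f" and ae: "AE x in unit_measure. cesaro_fun f x = z * f x"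
  shows "AE x in unit_measure. f x = 0"
proof (rule primitive_eq_zero_imp_AE_zero[OF f])
  fix y :: real assume y: "y \<in> {0<..<1}"
  show "cesaro_primitive f y = 0"
  proof (cases "z = 0")
    case True
    then show ?thesis
      using ae y by (intro primitive_eq_zero_if_AE_zero[OF f]) auto
  next
    case z: False
    obtain c where c: "\<And>x. x \<in> {0<..<1} \<Longrightarrow>
        cesaro_primitive f x = c * exp (1 / z * complex_of_real (ln (odds x)))"
      using eigenfunction_primitive[OF f z ae] by metis
    have "c = 0"
    proof (rule ccontr)
      assume "c \<noteq> 0"
      let ?u = "\<lambda>x. exp (2 * Re (1 / z) * ln (odds x)) / x\<^sup>2"
      have "AE x in unit_measure. (norm (z / c))\<^sup>2 * (norm (f x))\<^sup>2 = ?u x"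
        using ae AE_space
      proof eventually_elim
        fix x assume e: "cesaro_fun f x = z * f x" and "x \<in> space unit_measure"
        then have x: "x \<in> {0<..<1}" by simp
        have "z / c * f x = exp (1 / z * complex_of_real (ln (odds x))) / complex_of_real x"
          using e x \<open>c \<noteq> 0\<close> by (simp add: cesaro_fun_eq_primitive[OF f] c[OF x] field_simps)
        moreover have "Re (w * complex_of_real r) = Re w * r" for w r
          by simp
        ultimately have "norm (z / c * f x) = exp (Re (1 / z) * ln (odds x)) / \<bar>x\<bar>"
          by (simp only: norm_divide norm_exp_eq_Re norm_of_real)
        then show "(norm (z / c))\<^sup>2 * (norm (f x))\<^sup>2 = ?u x"
          by (metis exp_double mult.assoc norm_mult power_divide power_mult_distrib power2_abs)
      qed
      moreover have "integrable unit_measure (\<lambda>x. (norm (z / c))\<^sup>2 * (norm (f x))\<^sup>2)"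
        using f by (simp add: square_integrable_def)
      moreover have "?u \<in> borel_measurable unit_measure"
        by measurable
      ultimately have "integrable unit_measure ?u"
        using integrable_cong_AE_imp by blast
      then show False
        using odds_power_not_integrable by blast
    qed
    then show ?thesis
      using c[OF y] by simp
  qed
qed

lemma point_spectrum_cesaro: "point_spectrum cesaro = {}"
proof (rule ccontr)
  assume "point_spectrum cesaro \<noteq> {}"
  then obtain z g where g: "g \<noteq> 0" "cesaro g = l2_scale z g"
    by (auto simp: point_spectrum_def)
  obtain f where f: "square_integrable f" "g = abs_l2 f"
    by (rule l2_cases)
  have "abs_l2 (cesaro_fun f) = abs_l2 (\<lambda>x. z * f x)"
    using g(2) f by (simp add: cesaro_abs_l2 l2_scale.abs_eq l2_eq_refl)
  then have "AE x in unit_measure. cesaro_fun f x = z * f x"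
    using f by (simp add: abs_l2_eq_iff square_integrable_cesaro_fun square_integrable_scale)
  then have "AE x in unit_measure. f x = 0"
    by (rule eigenfunction_AE_zero[OF f(1)])
  then have "g = 0"
    using f by (simp add: zero_eq_abs_l2 abs_l2_eq_iff square_integrable_zero)
  with g(1) show False by simp
qed

theorem proposition2p14:
  shows "point_spectrum cesaro = {} \<and> point_spectrum (l2_adjoint cesaro) = {}"
  using point_spectrum_cesaro point_spectrum_adjoint_cesaro by simp

end
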